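(* Let $A=\{a_1,\ldots,a_m\}$ be a finite set of distinct real numbers. For every non-negative integer $l$, \[ R_l(A;x)=\big(R_1(A;x)\big)^l . \] Equivalently, for all non-negative integers $n$ and $l$, \[ r_l\big(\mathcal{B}_n^A\big)=\sum_{\substack{n_1+\cdots+n_l=n,\\ n_1,\ldots,n_l\ge 1}}\binom{n}{n_1,\ldots,n_l}\prod_{i=1}^l r_1\big(\mathcal{B}_{n_i}^A\big). \] Moreover, for any non-negative integers $k\le l$, \[ R_l(A;x)=R_k(A;x)\,R_{l-k}(A;x), \] that is, for every $n\ge 0$, \[ r_l(\mathcal{B}_n^A)=\sum_{i=0}^n\binom{n}{i}\,r_k(\mathcal{B}_i^A)\,r_{l-k}(\mathcal{B}_{n-i}^A). \]
   Context: For a finite set $A=\{a_1,\ldots,a_m\}$ of real numbers and $n\ge 0$, $\mathcal{B}_n^A$ is the hyperplane arrangement in $\mathbb{R}^n$ consisting of the hyperplanes $x_i-x_j=a_k$ for all $1\le i<j\le n$ and $k=1,\ldots,m$. A region of a hyperplane arrangement in $\mathbb{R}^n$ is a connected component of the complement of the union of its hyperplanes. The level $l(X)$ of a subset $X\subseteq\mathbb{R}^n$ is the smallest non-negative integer $l$ such that there exist a linear subspace $W\subseteq\mathbb{R}^n$ of dimension $l$ and a real $r>0$ with $X\subseteq\{\bm x\in\mathbb{R}^n:\min_{\bm w\in W}\|\bm x-\bm w\|\le r\}$. $r_l(\mathcal{A})$ denotes the number of regions of level $l$ of an arrangement $\mathcal{A}$, with the convention $r_0=1$ for the (empty) arrangement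 in $\mathbb{R}^0$; in particular $r_l(\mathcal{B}_n^A)=0$ for $l>n$. The exponential generating function is $R_l(A;x)=\sum_{n\ge 0} r_l(\mathcal{B}_n^A)\frac{x^n}{n!}$ (a formal power series).
   Formalization: The set A is assumed nonempty (m ≥ 1); for A empty the claim fails, since the empty arrangement in R^2 has one region, of level 2, while R_1 = x would give r_2 = 2. *)

theory Defs
  imports
    "HOL-Analysis.Analysis"
    "HOL-Library.Function_Algebras"
    "HOL-Computational_Algebra.Formal_Power_Series"
begin

text \<open>
  The dimension \<open>n\<close> varies within a single statement, so \<open>\<real>\<^sup>n\<close> is the library's
  \<open>Euclidean_space n\<close>: the functions \<open>nat \<Rightarrow> real\<close> vanishing at all indices \<open>\<ge> n\<close>, with the
  product topology. Coordinates are numbered \<open>0, \<dots>, n - 1\<close>.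
\<close>

global_interpretation rfun: vector_space "\<lambda>(c::real) (x :: nat \<Rightarrow> real) i. c * x i"
  by unfold_locales (auto simp: fun_eq_iff algebra_simps)

definition arrangement_B :: "real set \<Rightarrow> nat \<Rightarrow> (nat \<Rightarrow> real) set set" where
  "arrangement_B A n =
     {{x \<in> topspace (Euclidean_space n). x i - x j = a} | i j a. i < j \<and> j < n \<and> a \<in> A}"

definition regions :: "nat \<Rightarrow> (nat \<Rightarrow> real) set set \<Rightarrow> (nat \<Rightarrow> real) set set" where
  "regions n \<H> =
     connected_components_of
       (subtopology (Euclidean_space n) (topspace (Euclidean_space n) - \<Union>\<H>))"

text \<open>
  The infimum below is a minimum, since \<open>W\<close> is a subspace of a finite-dimensional space.
  \<open>L2_set z {..<n}\<close> is the Euclidean norm of \<open>z\<close> in \<open>\<real>\<^sup>n\<close>.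
\<close>

definition level :: "nat \<Rightarrow> (nat \<Rightarrow> real) set \<Rightarrow> nat" where
  "level n X =
     (LEAST l. \<exists>W r. rfun.subspace W \<and> W \<subseteq> topspace (Euclidean_space n) \<and> rfun.dim W = l \<and>
        r > 0 \<and>
        X \<subseteq> {x \<in> topspace (Euclidean_space n). (INF w\<in>W. L2_set (x - w) {..<n}) \<le> r})"

definition num_regions :: "nat \<Rightarrow> nat \<Rightarrow> (nat \<Rightarrow> real) set set \<Rightarrow> nat" where
  "num_regions l n \<H> = card {X \<in> regions n \<H>. level n X = l}"

definition region_egf :: "nat \<Rightarrow> real set \<Rightarrow> real fps" where
  "region_egf l A = Abs_fps (\<lambda>n. real (num_regions l n (arrangement_B A n)) / fact n)"

text \<open>The division is exact when \<open>sum_list ns = n\<close>.\<close>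

definition multinomial :: "nat \<Rightarrow> nat list \<Rightarrow> nat" where
  "multinomial n ns = fact n div (\<Prod>k\<leftarrow>ns. fact k)"

end

theory Submission
  imports Defs
begin

text \<open>
  A region is a cell of points lying on the same side of every hyperplane. Call a nonempty set
  \<open>U\<close> of coordinates a top set of a region if the region can be translated by any positive multiple
  of the indicator vector of \<open>U\<close> without leaving it, i.e. if every coordinate in \<open>U\<close> exceeds every
  coordinate outside \<open>U\<close> by more than all hyperplanes can detect. Top sets form a chain; their
  indicator vectors are linearly independent recession directions, and coordinates that no top set
  separates stay at bounded distance from each other on the region. Hence the level of a region is
  its number of top sets. Splitting a region at its smallest top set \<open>U\<close> gives a region of level 1 on
  the coordinates \<open>U\<close> and an arbitrary region on the remaining ones, and any such pair arises after
  shifting the coordinates in \<open>U\<close> far up. This yields \<open>R\<^sub>l\<^sub>+\<^sub>1 = R\<^sub>1 R\<^sub>l\<close>, and everything else is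
  formal.
\<close>

section \<open>Sign sets and their top sets\<close>

text \<open>Indices come from an arbitrary set \<open>S\<close> of naturals, so a point can be split
  into its parts on \<open>U\<close> and \<open>S - U\<close> without renumbering; values outside
  \<open>S\<close> are irrelevant.\<close>

definition generic :: "real set \<Rightarrow> nat set \<Rightarrow> (nat \<Rightarrow> real) \<Rightarrow> bool" where
  "generic A S x \<longleftrightarrow> (\<forall>i\<in>S. \<forall>j\<in>S. i < j \<longrightarrow> x i - x j \<notin> A)"

text \<open>A combinatorial name for a region. Only positive sides are recorded: for generic
  \<open>x\<close>, a triple missing from the set stands for the strict opposite inequality.\<close>

definition sign_set :: "real set \<Rightarrow> nat set \<Rightarrow> (nat \<Rightarrow> real) \<Rightarrow> (nat \<times> nat \<times> real) set" where
  "sign_set A S x = {(i, j, a). i \<in> S \<and> j \<in> S \<and> i < j \<and> a \<in> A \<and> a < x i - x j}"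

definition sign_sets :: "real set \<Rightarrow> nat set \<Rightarrow> (nat \<times> nat \<times> real) set set" where
  "sign_sets A S = sign_set A S ` {x. generic A S x}"

text \<open>
  In terms of a point \<open>x\<close> with sign set \<open>\<sigma>\<close>, \<open>far_above A \<sigma> j i\<close> says that \<open>x j - x i\<close> lies in the
  unbounded interval \<open>x j - x i > Max A\<close> (if \<open>j < i\<close>) or \<open>x i - x j < Min A\<close> (if \<open>i < j\<close>).
\<close>

definition far_above :: "real set \<Rightarrow> (nat \<times> nat \<times> real) set \<Rightarrow> nat \<Rightarrow> nat \<Rightarrow> bool" where
  "far_above A \<sigma> j i \<longleftrightarrow> (if j < i then (j, i, Max A) \<in> \<sigma> else (i, j, Min A) \<notin> \<sigma>)"

text \<open>A nonempty \<open>S\<close> is vacuously a top set of itself; it stands for the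
  direction \<open>(1, ..., 1)\<close>, along which every region is invariant.\<close>

definition top_sets :: "real set \<Rightarrow> nat set \<Rightarrow> (nat \<times> nat \<times> real) set \<Rightarrow> nat set set" where
  "top_sets A S \<sigma> = {U. U \<subseteq> S \<and> U \<noteq> {} \<and> (\<forall>j\<in>U. \<forall>i\<in>S - U. far_above A \<sigma> j i)}"

definition num_sign_sets :: "real set \<Rightarrow> nat set \<Rightarrow> nat \<Rightarrow> nat" where
  "num_sign_sets A S l = card {\<sigma> \<in> sign_sets A S. card (top_sets A S \<sigma>) = l}"

definition restr :: "nat set \<Rightarrow> (nat \<times> nat \<times> real) set \<Rightarrow> (nat \<times> nat \<times> real) set" where
  "restr U \<sigma> = \<sigma> \<inter> U \<times> U \<times> UNIV"

section \<open>Restriction and relabelling of sign sets\<close>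

lemma sign_sets_subset: "\<sigma> \<in> sign_sets A S \<Longrightarrow> \<sigma> \<subseteq> S \<times> S \<times> A"
  by (auto simp: sign_sets_def sign_set_def)

lemma finite_sign_sets:
  assumes "finite A" "finite S"
  shows "finite (sign_sets A S)"
proof (rule finite_subset)
  show "sign_sets A S \<subseteq> Pow (S \<times> S \<times> A)"
    using sign_sets_subset by blast
qed (use assms in auto)

lemma finite_top_sets: "finite S \<Longrightarrow> finite (top_sets A S \<sigma>)"
  by (rule finite_subset[of _ "Pow S"]) (auto simp: top_sets_def)

lemma far_above_restr: "i \<in> U \<Longrightarrow> j \<in> U \<Longrightarrow> far_above A (restr U \<sigma>) i j = far_above A \<sigma> i j"
  by (auto simp: far_above_def restr_def)

text \<open>Only indices inside \<open>U\<close> are compared. Hence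
  \<open>top_sets A U \<sigma>\<close> can be used directly for a sign set \<open>\<sigma>\<close>
  on a larger index set.\<close>

lemma top_sets_restr: "top_sets A U (restr U \<sigma>) = top_sets A U \<sigma>"
  by (auto simp: top_sets_def subset_iff far_above_restr)

lemma generic_mono: "generic A S x \<Longrightarrow> U \<subseteq> S \<Longrightarrow> generic A U x"
  by (auto simp: generic_def)

lemma restr_sign_set: "U \<subseteq> S \<Longrightarrow> restr U (sign_set A S x) = sign_set A U x"
  by (auto simp: restr_def sign_set_def)

lemma restr_in_sign_sets: "\<sigma> \<in> sign_sets A S \<Longrightarrow> U \<subseteq> S \<Longrightarrow> restr U \<sigma> \<in> sign_sets A U"
  by (auto simp: sign_sets_def restr_sign_set intro: generic_mono)

lemma generic_cong: "(\<And>i. i \<in> S \<Longrightarrow> x i = y i) \<Longrightarrow> generic A S x = generic A S y"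
  by (simp add: generic_def)

lemma sign_set_cong: "(\<And>i. i \<in> S \<Longrightarrow> x i = y i) \<Longrightarrow> sign_set A S x = sign_set A S y"
  by (auto simp: sign_set_def)

lemma sign_sets_empty: "sign_sets A {} = {{}}"
  by (auto simp: sign_sets_def sign_set_def generic_def)

lemma top_sets_empty: "top_sets A {} \<sigma> = {}"
  by (auto simp: top_sets_def)

lemma num_sign_sets_empty: "num_sign_sets A {} l = (if l = 0 then 1 else 0)"
  by (auto simp: num_sign_sets_def sign_sets_empty top_sets_empty Collect_conv_if)

text \<open>Since \<open>S\<close> is a top set of itself, level 0 is left to the empty index
  set.\<close>

lemma num_sign_sets_0:
  assumes "finite S" "S \<noteq> {}"
  shows "num_sign_sets A S 0 = 0"
proof -
  have "S \<in> top_sets A S \<sigma>" for \<sigma>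
    using assms by (auto simp: top_sets_def)
  then have "card (top_sets A S \<sigma>) \<noteq> 0" for \<sigma>
    using finite_top_sets[OF assms(1)] by (metis card_0_eq emptyE)
  then show ?thesis
    unfolding num_sign_sets_def by (metis (mono_tags, lifting) card.empty empty_Collect_eq)
qed

text \<open>An increasing bijection \<open>h\<close> carries everything over, because sign sets and
  \<open>far_above\<close> use nothing about indices but their order. Monotonicity matters:
  reversing a pair would replace \<open>A\<close> by its negative.\<close>

lemma num_sign_sets_card:
  assumes "finite S"
  shows "num_sign_sets A S l = num_sign_sets A {..<card S} l"
proof -
  define n where "n = card S"
  let ?N = "{..<n}"
  obtain h where h: "bij_betw h ?N S" "strict_mono_on ?N h"
    using ex_bij_betw_strict_mono_card[OF assms] unfolding n_def .
  have inj: "inj_on h ?N" and im: "h ` ?N = S"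
    using h(1) by (auto simp: bij_betw_def)
  have less: "h i < h j \<longleftrightarrow> i < j" if "i < n" "j < n" for i j
    using strict_mono_on_less[OF h(2), of i j] that by simp
  define g where "g = (\<lambda>(i, j, a::real). (h i, h j, a))"
  have injg: "inj_on g (?N \<times> ?N \<times> UNIV)"
    using inj by (auto simp: g_def inj_on_def)
  have gen: "generic A S x = generic A ?N (x \<circ> h)" for x
    unfolding generic_def im[symmetric] by (auto simp: less)
  have sgn: "sign_set A S x = g ` sign_set A ?N (x \<circ> h)" for x
    unfolding sign_set_def im[symmetric]
    by (auto simp: less g_def image_iff intro: order_less_trans) (blast intro: order_less_trans)
  have sgns: "sign_sets A S = (`) g ` sign_sets A ?N"
  proof (rule subset_antisym)
    show "sign_sets A S \<subseteq> (`) g ` sign_sets A ?N"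
      by (auto simp: sign_sets_def sgn gen)
    show "(`) g ` sign_sets A ?N \<subseteq> sign_sets A S"
    proof clarify
      fix \<sigma> assume "\<sigma> \<in> sign_sets A ?N"
      then obtain y where y: "generic A ?N y" "\<sigma> = sign_set A ?N y"
        by (auto simp: sign_sets_def)
      \<comment> \<open>\<open>x \<circ> h\<close> is only known to agree with \<open>y\<close> on
        \<open>?N\<close>, which is all that \<open>generic\<close> and \<open>sign_set\<close>
        see.\<close>
      define x where "x = y \<circ> inv_into ?N h"
      have eq: "(x \<circ> h) i = y i" if "i \<in> ?N" for i
        using that inj by (simp add: x_def)
      have "generic A S x" "g ` \<sigma> = sign_set A S x"
        using y generic_cong[of ?N "x \<circ> h" y] sign_set_cong[of ?N "x \<circ> h" y] eq
        by (auto simp: gen sgn)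
      then show "g ` \<sigma> \<in> sign_sets A S"
        by (auto simp: sign_sets_def)
    qed
  qed
  have mem: "(h i, h j, a) \<in> g ` \<sigma> \<longleftrightarrow> (i, j, a) \<in> \<sigma>"
    if "\<sigma> \<in> sign_sets A ?N" "i < n" "j < n" for \<sigma> i j a
  proof -
    have "(h i, h j, a) = g (i, j, a)"
      by (simp add: g_def)
    then show ?thesis
      using inj_on_image_mem_iff[OF injg, of "(i, j, a)" \<sigma>] sign_sets_subset[OF that(1)] that
      by auto
  qed
  have tops: "top_sets A S (g ` \<sigma>) = (`) h ` top_sets A ?N \<sigma>" if \<sigma>: "\<sigma> \<in> sign_sets A ?N" for \<sigma>
  proof -
    have ab: "far_above A (g ` \<sigma>) (h j) (h i) = far_above A \<sigma> j i" if "j < n" "i < n" for i j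
      using that mem[OF \<sigma>] less by (simp add: far_above_def)
    have iff: "h ` U \<in> top_sets A S (g ` \<sigma>) \<longleftrightarrow> U \<in> top_sets A ?N \<sigma>" if U: "U \<subseteq> ?N" for U
    proof -
      have "S - h ` U = h ` (?N - U)"
        using inj_on_image_set_diff[OF inj, of ?N U] U im by simp
      moreover have "h ` U \<subseteq> S"
        using U im by blast
      moreover have "(\<forall>j\<in>U. \<forall>i\<in>?N - U. far_above A (g ` \<sigma>) (h j) (h i)) \<longleftrightarrow>
          (\<forall>j\<in>U. \<forall>i\<in>?N - U. far_above A \<sigma> j i)"
        using U by (intro ball_cong refl ab) auto
      ultimately show ?thesis
        using U unfolding top_sets_def by auto
    qed
    show ?thesis
    proof (rule subset_antisym)
      show "top_sets A S (g ` \<sigma>) \<subseteq> (`) h ` top_sets A ?N \<sigma>"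
      proof
        fix V assume V: "V \<in> top_sets A S (g ` \<sigma>)"
        then have "V \<subseteq> h ` ?N"
          by (auto simp: im top_sets_def)
        then obtain U where "U \<subseteq> ?N" "V = h ` U"
          by (auto simp: subset_image_iff)
        then show "V \<in> (`) h ` top_sets A ?N \<sigma>"
          using V iff by auto
      qed
      show "(`) h ` top_sets A ?N \<sigma> \<subseteq> top_sets A S (g ` \<sigma>)"
      proof clarify
        fix U assume "U \<in> top_sets A ?N \<sigma>"
        moreover from this have "U \<subseteq> ?N"
          by (simp add: top_sets_def)
        ultimately show "h ` U \<in> top_sets A S (g ` \<sigma>)"
          using iff by blast
      qed
    qed
  qed
  have card_tops: "card (top_sets A S (g ` \<sigma>)) = card (top_sets A ?N \<sigma>)"
    if "\<sigma> \<in> sign_sets A ?N" for \<sigma>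
    unfolding tops[OF that]
    by (rule card_image, rule inj_on_subset[OF inj_on_image_Pow[OF inj]]) (auto simp: top_sets_def)
  have "{\<sigma> \<in> sign_sets A S. card (top_sets A S \<sigma>) = l}
      = (`) g ` {\<sigma> \<in> sign_sets A ?N. card (top_sets A ?N \<sigma>) = l}"
    by (auto simp: sgns card_tops)
  moreover have "inj_on ((`) g) {\<sigma> \<in> sign_sets A ?N. card (top_sets A ?N \<sigma>) = l}"
    by (rule inj_on_subset[OF inj_on_image_Pow[OF injg]]) (auto dest!: sign_sets_subset)
  ultimately show ?thesis
    by (simp add: num_sign_sets_def card_image n_def)
qed

section \<open>The chain of top sets and its decomposition\<close>

text \<open>For \<open>i < j\<close> the two relations would give \<open>Max A < x i - x j\<close>
  and \<open>x i - x j \<le> Min A\<close>; the case \<open>j < i\<close> is symmetric.\<close>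

lemma far_above_antisym:
  assumes "finite A" "A \<noteq> {}" "\<sigma> \<in> sign_sets A S" "far_above A \<sigma> i j" "far_above A \<sigma> j i" "i \<in> S" "j \<in> S"
  shows "i = j"
proof (rule ccontr)
  assume "i \<noteq> j"
  obtain x where x: "\<sigma> = sign_set A S x"
    using assms(3) by (auto simp: sign_sets_def)
  have "Min A \<le> Max A" "Min A \<in> A"
    using assms by auto
  then show False
    using assms \<open>i \<noteq> j\<close>
    by (auto simp: x far_above_def sign_set_def split: if_splits)
qed

text \<open>An index in \<open>U - V\<close> and one in \<open>V - U\<close> would each be far above
  the other.\<close>

lemma top_sets_chain:
  assumes "finite A" "A \<noteq> {}" "\<sigma> \<in> sign_sets A S" "U \<in> top_sets A S \<sigma>" "V \<in> top_sets A S \<sigma>"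
  shows "U \<subseteq> V \<or> V \<subseteq> U"
proof (rule ccontr)
  assume "\<not> ?thesis"
  then obtain i j where ij: "i \<in> U - V" "j \<in> V - U"
    by blast
  then have "far_above A \<sigma> i j" "far_above A \<sigma> j i" "i \<in> S" "j \<in> S"
    using assms by (auto simp: top_sets_def)
  then show False
    using far_above_antisym[OF assms(1-3)] ij by blast
qed

text \<open>By the chain property every top set lies inside \<open>U\<close> or contains it, and in
  the second case \<open>U\<close> can be removed. Conversely, indices in \<open>U\<close> are far
  above everything outside \<open>U\<close>, so top sets of either part extend to
  \<open>S\<close>.\<close>

lemma top_sets_decompose:
  assumes "finite A" "A \<noteq> {}" "\<sigma> \<in> sign_sets A S" "U \<in> top_sets A S \<sigma>"
  shows "top_sets A S \<sigma> = top_sets A U \<sigma> \<union> (\<union>) U ` top_sets A (S - U) \<sigma>"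
proof (rule subset_antisym; rule subsetI)
  fix V assume V: "V \<in> top_sets A S \<sigma>"
  consider "V \<subseteq> U" | "U \<subset> V"
    using top_sets_chain[OF assms V] by blast
  then show "V \<in> top_sets A U \<sigma> \<union> (\<union>) U ` top_sets A (S - U) \<sigma>"
  proof cases
    case 1
    then show ?thesis
      using V assms(4) by (auto simp: top_sets_def)
  next
    case 2
    then have "V = U \<union> (V - U)" "V - U \<in> top_sets A (S - U) \<sigma>"
      using V by (auto simp: top_sets_def)
    then show ?thesis
      by blast
  qed
next
  fix V assume "V \<in> top_sets A U \<sigma> \<union> (\<union>) U ` top_sets A (S - U) \<sigma>"
  then show "V \<in> top_sets A S \<sigma>"
  proof
    assume V: "V \<in> top_sets A U \<sigma>"
    have "far_above A \<sigma> j i" if "j \<in> V" "i \<in> S - V" for i j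
      using that V assms(4) by (cases "i \<in> U") (auto simp: top_sets_def)
    then show ?thesis
      using V assms(4) by (auto simp: top_sets_def)
  next
    assume "V \<in> (\<union>) U ` top_sets A (S - U) \<sigma>"
    then show ?thesis
      using assms(4) by (auto simp: top_sets_def)
  qed
qed

text \<open>The union is disjoint: top sets of \<open>S - U\<close> are nonempty, so adding
  \<open>U\<close> to one never yields a subset of \<open>U\<close>.\<close>

lemma card_top_sets_decompose:
  assumes "finite A" "A \<noteq> {}" "\<sigma> \<in> sign_sets A S" "U \<in> top_sets A S \<sigma>" "finite S"
  shows "card (top_sets A S \<sigma>) = card (top_sets A U \<sigma>) + card (top_sets A (S - U) \<sigma>)"
proof -
  have "inj_on ((\<union>) U) (top_sets A (S - U) \<sigma>)"
    by (auto simp: inj_on_def top_sets_def)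
  moreover have "top_sets A U \<sigma> \<inter> (\<union>) U ` top_sets A (S - U) \<sigma> = {}"
    by (auto simp: top_sets_def)
  moreover have "U \<subseteq> S"
    using assms by (auto simp: top_sets_def)
  ultimately show ?thesis
    using assms(5) finite_subset[OF \<open>U \<subseteq> S\<close>]
    by (simp add: top_sets_decompose[OF assms(1-4)] card_Un_disjoint card_image finite_top_sets)
qed

section \<open>Splitting at a top set and the counting recursion\<close>

text \<open>Injective, because a top set \<open>U\<close> forces all triples that mix
  \<open>U\<close> and \<open>S - U\<close>. Surjective, because two points chosen independently on
  the two parts can be glued after a large shift of the \<open>U\<close> coordinates.\<close>

lemma bij_betw_restr_pair:
  assumes A: "finite A" "A \<noteq> {}" and S: "finite S" and U: "U \<subseteq> S" "U \<noteq> {}"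
  shows "bij_betw (\<lambda>\<sigma>. (restr U \<sigma>, restr (S - U) \<sigma>))
           {\<sigma> \<in> sign_sets A S. U \<in> top_sets A S \<sigma>} (sign_sets A U \<times> sign_sets A (S - U))"
    (is "bij_betw ?f ?X ?Y")
  unfolding bij_betw_def
proof
  have Min_Max: "Min A \<le> a" "a \<le> Max A" if "a \<in> A" for a
    using A that by auto
  have upper: "a < x j - x i"
    if "U \<in> top_sets A S (sign_set A S x)" "j \<in> U" "i \<in> S - U" "j < i" "a \<in> A" for a i j x
  proof -
    have "(j, i, Max A) \<in> sign_set A S x"
      using that by (auto simp: top_sets_def far_above_def)
    then show ?thesis
      using Min_Max[OF that(5)] by (auto simp: sign_set_def)
  qed
  have lower: "\<not> a < x i - x j"
    if "U \<in> top_sets A S (sign_set A S x)" "j \<in> U" "i \<in> S - U" "i < j" "a \<in> A" for a i j x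
  proof -
    have "(i, j, Min A) \<notin> sign_set A S x"
      using that by (auto simp: top_sets_def far_above_def)
    then show ?thesis
      using that(2-5) A U Min_Max[OF that(5)] by (force simp: sign_set_def)
  qed
  \<comment> \<open>Among mixed triples, those with first index in \<open>U\<close> all occur and
    those with first index outside \<open>U\<close> never do, whatever \<open>\<sigma>\<close>
    is.\<close>
  have cross: "(i, j, a) \<in> \<sigma> \<longleftrightarrow> i < j \<and> i \<in> U \<and> j \<in> S - U \<and> a \<in> A
       \<or> (i, j, a) \<in> restr U \<sigma> \<or> (i, j, a) \<in> restr (S - U) \<sigma>" if \<sigma>: "\<sigma> \<in> ?X" for i j a \<sigma>
  proof -
    obtain x where x: "\<sigma> = sign_set A S x" "U \<in> top_sets A S (sign_set A S x)"
      using \<sigma> by (auto simp: sign_sets_def)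
    show ?thesis
      using upper[OF x(2), of i j a] lower[OF x(2), of j i a] U
      by (auto simp: x(1) restr_def sign_set_def)
  qed
  show "inj_on ?f ?X"
  proof (rule inj_onI)
    fix \<sigma> \<tau> assume "\<sigma> \<in> ?X" "\<tau> \<in> ?X" "?f \<sigma> = ?f \<tau>"
    then have "t \<in> \<sigma> \<longleftrightarrow> t \<in> \<tau>" for t
      using cross[of \<sigma> "fst t" "fst (snd t)" "snd (snd t)"]
        cross[of \<tau> "fst t" "fst (snd t)" "snd (snd t)"] by simp
    then show "\<sigma> = \<tau>"
      by blast
  qed
  show "?f ` ?X = ?Y"
  proof (rule subset_antisym)
    show "?f ` ?X \<subseteq> ?Y"
      using U by (auto intro: restr_in_sign_sets)
    show "?Y \<subseteq> ?f ` ?X"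
    proof clarify
      fix \<sigma> \<tau> assume "\<sigma> \<in> sign_sets A U" "\<tau> \<in> sign_sets A (S - U)"
      then obtain y z where y: "generic A U y" "\<sigma> = sign_set A U y"
        and z: "generic A (S - U) z" "\<tau> = sign_set A (S - U) z"
        by (auto simp: sign_sets_def)
      define B where "B = (\<Sum>i\<in>S. \<bar>y i\<bar> + \<bar>z i\<bar>)"
      have B: "\<bar>y j\<bar> + \<bar>z i\<bar> \<le> B + B" if "i \<in> S" "j \<in> S" for i j
        using member_le_sum[of i S "\<lambda>i. \<bar>y i\<bar> + \<bar>z i\<bar>"] member_le_sum[of j S "\<lambda>i. \<bar>y i\<bar> + \<bar>z i\<bar>"]
          that S unfolding B_def by fastforce
      \<comment> \<open>\<open>B + B\<close> bounds
        \<open>\<bar>y j\<bar> + \<bar>z i\<bar>\<close>, so after the shift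
        \<open>x j - x i\<close> is at least
        \<open>\<bar>Max A\<bar> + \<bar>Min A\<bar> + 1\<close> for \<open>j\<close> in
        \<open>U\<close> and \<open>i\<close> in \<open>S - U\<close>.\<close>
      define M where "M = B + B + \<bar>Max A\<bar> + \<bar>Min A\<bar> + 1"
      define x where "x i = (if i \<in> U then y i + M else z i)" for i
      have far: "x j - x i > Max A" "x i - x j < Min A" if "j \<in> U" "i \<in> S - U" for i j
        using B[of i j] that U by (auto simp: x_def M_def)
      have "generic A S x"
        unfolding generic_def
      proof (intro ballI impI)
        fix i j assume ij: "i \<in> S" "j \<in> S" "i < j"
        show "x i - x j \<notin> A"
        proof (cases "i \<in> U \<longleftrightarrow> j \<in> U")
          case True
          then have "x i - x j = (if i \<in> U then y i - y j else z i - z j)"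
            by (simp add: x_def)
          then show ?thesis
            using True ij y(1) z(1) by (simp add: generic_def)
        next
          case False
          then have "x i - x j < Min A \<or> Max A < x i - x j"
            using far ij by blast
          then show ?thesis
            using Min_Max[of "x i - x j"] by linarith
        qed
      qed
      moreover have "U \<in> top_sets A S (sign_set A S x)"
      proof -
        have "far_above A (sign_set A S x) j i" if "j \<in> U" "i \<in> S - U" for i j
          using far[OF that] that U Max_in[OF A]
          by (auto simp: far_above_def sign_set_def simp del: Max_less_iff Min_gr_iff)
        then show ?thesis
          using U by (simp add: top_sets_def)
      qed
      moreover have "restr U (sign_set A S x) = \<sigma>"
        unfolding y(2) restr_sign_set[OF U(1)] by (auto simp: x_def sign_set_def)
      moreover have "restr (S - U) (sign_set A S x) = \<tau>"
        unfolding z(2) by (subst restr_sign_set) (auto simp: x_def intro!: sign_set_cong)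
      ultimately show "(\<sigma>, \<tau>) \<in> ?f ` ?X"
        by (auto simp: sign_sets_def image_iff)
    qed
  qed
qed

text \<open>Sign sets are sorted by their smallest top set \<open>U\<close>, recognised by
  \<open>U\<close> having just one top set. The remaining \<open>l\<close> top sets come from
  \<open>S - U\<close>.\<close>

lemma num_sign_sets_Suc_subsets:
  assumes A: "finite A" "A \<noteq> {}" and S: "finite S"
  shows "num_sign_sets A S (Suc l) =
    (\<Sum>U\<in>Pow S. num_sign_sets A U 1 * num_sign_sets A (S - U) l)"
proof -
  define X where "X U = {\<sigma> \<in> sign_sets A S. U \<in> top_sets A S \<sigma> \<and> card (top_sets A U \<sigma>) = 1 \<and>
    card (top_sets A (S - U) \<sigma>) = l}" for U
  have "{\<sigma> \<in> sign_sets A S. card (top_sets A S \<sigma>) = Suc l} = (\<Union>U\<in>Pow S. X U)"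
  proof (rule subset_antisym; rule subsetI)
    fix \<sigma> assume "\<sigma> \<in> {\<sigma> \<in> sign_sets A S. card (top_sets A S \<sigma>) = Suc l}"
    then have \<sigma>: "\<sigma> \<in> sign_sets A S" "card (top_sets A S \<sigma>) = Suc l"
      by auto
    then have "top_sets A S \<sigma> \<noteq> {}"
      by auto
    \<comment> \<open>Minimality leaves \<open>U\<close> as the only top set of \<open>U\<close>, so
      it accounts for exactly 1 of the \<open>Suc l\<close>.\<close>
    from finite_has_minimal[OF finite_top_sets[OF S] this] obtain U where
      U: "U \<in> top_sets A S \<sigma>" and min: "\<And>V. V \<in> top_sets A S \<sigma> \<Longrightarrow> V \<subseteq> U \<Longrightarrow> U = V"
      by blast
    have "top_sets A U \<sigma> \<subseteq> {U}"
    proof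
      fix V assume V: "V \<in> top_sets A U \<sigma>"
      then have "V \<in> top_sets A S \<sigma>"
        using top_sets_decompose[OF A \<sigma>(1) U] by blast
      then show "V \<in> {U}"
        using min V by (auto simp: top_sets_def)
    qed
    moreover have "U \<in> top_sets A U \<sigma>" "U \<subseteq> S"
      using U by (auto simp: top_sets_def)
    ultimately have "top_sets A U \<sigma> = {U}"
      by blast
    then have "\<sigma> \<in> X U"
      using card_top_sets_decompose[OF A \<sigma>(1) U S] \<sigma> U by (simp add: X_def)
    with \<open>U \<subseteq> S\<close> show "\<sigma> \<in> (\<Union>U\<in>Pow S. X U)"
      by blast
  next
    fix \<sigma> assume "\<sigma> \<in> (\<Union>U\<in>Pow S. X U)"
    then show "\<sigma> \<in> {\<sigma> \<in> sign_sets A S. card (top_sets A S \<sigma>) = Suc l}"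
      using card_top_sets_decompose[OF A _ _ S] by (auto simp: X_def)
  qed
  moreover have "X U \<inter> X V = {}" if "U \<noteq> V" for U V
  proof (rule ccontr)
    assume "X U \<inter> X V \<noteq> {}"
    then obtain \<sigma> where \<sigma>: "\<sigma> \<in> X U" "\<sigma> \<in> X V"
      by blast
    \<comment> \<open>Both \<open>W\<close> and \<open>W'\<close> would be top sets of
      \<open>W\<close>, which has only one.\<close>
    have sub: "W' = W" if "\<sigma> \<in> X W" "\<sigma> \<in> X W'" "W' \<subseteq> W" for W W'
    proof -
      have "W \<in> top_sets A W \<sigma>" "W' \<in> top_sets A W \<sigma>"
        using that by (auto simp: X_def top_sets_def)
      moreover have "card (top_sets A W \<sigma>) = 1"
        using that by (simp add: X_def)
      ultimately show "W' = W"
        by (metis card_1_singletonE singletonD)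
    qed
    have "U \<subseteq> V \<or> V \<subseteq> U"
      by (rule top_sets_chain[OF A, of \<sigma> S]) (use \<sigma> in \<open>auto simp: X_def\<close>)
    then show False
      using sub \<sigma> that by blast
  qed
  moreover have "finite (X U)" for U
    using finite_sign_sets[OF A(1) S] by (simp add: X_def)
  ultimately have "num_sign_sets A S (Suc l) = (\<Sum>U\<in>Pow S. card (X U))"
    using S by (simp add: num_sign_sets_def card_UN_disjoint)
  also have "\<dots> = (\<Sum>U\<in>Pow S. num_sign_sets A U 1 * num_sign_sets A (S - U) l)"
  proof (rule sum.cong)
    fix U assume "U \<in> Pow S"
    then have U: "U \<subseteq> S"
      by simp
    show "card (X U) = num_sign_sets A U 1 * num_sign_sets A (S - U) l"
    proof (cases "U = {}")
      \<comment> \<open>Both sides are 0: an empty index set has no top set.\<close>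
      case True
      then show ?thesis
        by (simp add: X_def num_sign_sets_empty top_sets_empty)
    next
      case False
      let ?f = "\<lambda>\<sigma>. (restr U \<sigma>, restr (S - U) \<sigma>)"
      let ?Y = "{\<sigma> \<in> sign_sets A U. card (top_sets A U \<sigma>) = 1} \<times>
        {\<sigma> \<in> sign_sets A (S - U). card (top_sets A (S - U) \<sigma>) = l}"
      note bij = bij_betw_restr_pair[OF A S U False]
      have "inj_on ?f (X U)"
        by (rule inj_on_subset[OF bij_betw_imp_inj_on[OF bij]]) (auto simp: X_def)
      moreover have "?f ` X U = ?Y"
      proof (rule subset_antisym)
        show "?f ` X U \<subseteq> ?Y"
          using U by (auto simp: X_def top_sets_restr intro: restr_in_sign_sets)
        show "?Y \<subseteq> ?f ` X U"
        proof
          fix p assume p: "p \<in> ?Y"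
          then have "p \<in> ?f ` {\<sigma> \<in> sign_sets A S. U \<in> top_sets A S \<sigma>}"
            using bij_betw_imp_surj_on[OF bij] by blast
          then show "p \<in> ?f ` X U"
            using p by (auto simp: X_def top_sets_restr image_iff)
        qed
      qed
      ultimately have "card (X U) = card ?Y"
        using card_image[of ?f "X U"] by simp
      then show ?thesis
        by (simp add: num_sign_sets_def card_cartesian_product)
    qed
  qed simp
  finally show ?thesis .
qed

text \<open>By \<open>num_sign_sets_card\<close> the summand for \<open>U\<close> depends only on
  \<open>card U\<close>, and the binomial coefficient counts the subsets of each size.\<close>

lemma num_sign_sets_Suc:
  assumes "finite A" "A \<noteq> {}"
  shows "num_sign_sets A {..<n} (Suc l) =
    (\<Sum>i=0..n. (n choose i) * num_sign_sets A {..<i} 1 * num_sign_sets A {..<n - i} l)"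
proof -
  let ?f = "\<lambda>i. num_sign_sets A {..<i} 1 * num_sign_sets A {..<n - i} l"
  have "num_sign_sets A {..<n} (Suc l) = (\<Sum>U\<in>Pow {..<n}. ?f (card U))"
    unfolding num_sign_sets_Suc_subsets[OF assms finite_lessThan]
  proof (rule sum.cong[OF refl])
    fix U assume "U \<in> Pow {..<n}"
    then have "finite U" "finite ({..<n} - U)" "card ({..<n} - U) = n - card U"
      by (auto simp: card_Diff_subset finite_subset)
    then show "num_sign_sets A U 1 * num_sign_sets A ({..<n} - U) l = ?f (card U)"
      using num_sign_sets_card by metis
  qed
  also have "\<dots> = (\<Sum>i=0..n. \<Sum>U | U \<in> Pow {..<n} \<and> card U = i. ?f (card U))"
  proof (rule sum.group[symmetric])
    show "card ` Pow {..<n} \<subseteq> {0..n}"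
      using card_mono[of "{..<n}"] by fastforce
  qed auto
  also have "\<dots> = (\<Sum>i=0..n. (n choose i) * num_sign_sets A {..<i} 1 * num_sign_sets A {..<n - i} l)"
  proof (rule sum.cong[OF refl])
    fix i
    have "(\<Sum>U | U \<in> Pow {..<n} \<and> card U = i. ?f (card U)) = (\<Sum>U | U \<in> Pow {..<n} \<and> card U = i. ?f i)"
      by (rule sum.cong) auto
    then show "(\<Sum>U | U \<in> Pow {..<n} \<and> card U = i. ?f (card U)) =
      (n choose i) * num_sign_sets A {..<i} 1 * num_sign_sets A {..<n - i} l"
      using n_subsets[of "{..<n}" i] by (simp add: mult.assoc)
  qed
  finally show ?thesis .
qed

section \<open>Regions as cells\<close>

definition cell :: "real set \<Rightarrow> nat \<Rightarrow> (nat \<times> nat \<times> real) set \<Rightarrow> (nat \<Rightarrow> real) set" where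
  "cell A n \<sigma> = {x \<in> topspace (Euclidean_space n). generic A {..<n} x \<and> sign_set A {..<n} x = \<sigma>}"

lemma complement_arrangement_B:
  "topspace (Euclidean_space n) - \<Union>(arrangement_B A n) =
    {x \<in> topspace (Euclidean_space n). generic A {..<n} x}"
  by (auto simp: arrangement_B_def generic_def)

lemma same_signD:
  assumes "sign_set A S x = sign_set A S y" "i \<in> S" "j \<in> S" "i < j" "a \<in> A"
  shows "a < x i - x j \<longleftrightarrow> a < y i - y j"
proof -
  have "(i, j, a) \<in> sign_set A S x \<longleftrightarrow> (i, j, a) \<in> sign_set A S y"
    using assms by simp
  then show ?thesis
    using assms by (simp add: sign_set_def)
qed

lemma continuous_map_Euclidean_space_diff:
  "continuous_map (Euclidean_space n) euclideanreal (\<lambda>x. x i - x j)"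
  unfolding Euclidean_space_def
  by (intro continuous_map_from_subtopology continuous_map_diff continuous_map_product_coordinates) auto

lemma connectedin_segment:
  assumes "x \<in> topspace (Euclidean_space n)" "y \<in> topspace (Euclidean_space n)"
  shows "connectedin (Euclidean_space n) ((\<lambda>t i. (1 - t) * x i + t * y i) ` {0..1})"
proof (rule connectedin_continuous_map_image)
  show "continuous_map euclideanreal (Euclidean_space n) (\<lambda>t i. (1 - t) * x i + t * y i)"
    using assms unfolding Euclidean_space_def continuous_map_in_subtopology
    by (auto simp: continuous_map_componentwise_UNIV intro!: continuous_intros)
qed auto

text \<open>Cells are convex, being cut out by strict linear inequalities.\<close>

lemma segment_in_cell:
  assumes "x \<in> cell A n \<sigma>" "y \<in> cell A n \<sigma>" "0 \<le> t" "t \<le> 1"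
  shows "(\<lambda>i. (1 - t) * x i + t * y i) \<in> cell A n \<sigma>"
proof -
  define z where "z = (\<lambda>i. (1 - t) * x i + t * y i)"
  have top: "z \<in> topspace (Euclidean_space n)"
    using assms by (auto simp: cell_def topspace_Euclidean_space z_def)
  have same: "sign_set A {..<n} x = sign_set A {..<n} y"
    using assms by (simp add: cell_def)
  have diff: "z i - z j = (1 - t) * (x i - x j) + t * (y i - y j)" for i j
    by (simp add: z_def algebra_simps)
  have sides: "z i - z j \<noteq> a \<and> (a < z i - z j \<longleftrightarrow> a < x i - x j)"
    if ij: "i < j" "j < n" "a \<in> A" for i j a
  proof (cases "a < x i - x j")
    case True
    then have "a < y i - y j"
      using same_signD[OF same, of i j a] ij by simp
    \<comment> \<open>\<open>convex_bound_lt\<close> gives upper bounds, so it is applied to the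
      negated differences.\<close>
    then have "a < z i - z j"
      using True assms convex_bound_lt[of "- (x i - x j)" "- a" "- (y i - y j)" "1 - t" t]
      by (simp add: diff algebra_simps)
    then show ?thesis
      using True by simp
  next
    case False
    have "x i - x j \<noteq> a" "y i - y j \<noteq> a"
      using assms(1,2) ij by (auto simp: cell_def generic_def)
    then have "x i - x j < a" "y i - y j < a"
      using False same_signD[OF same, of i j a] ij by auto
    then have "z i - z j < a"
      using assms convex_bound_lt[of "x i - x j" a "y i - y j" "1 - t" t] by (simp add: diff)
    then show ?thesis
      using False by simp
  qed
  have "generic A {..<n} z" "sign_set A {..<n} z = sign_set A {..<n} x"
    using sides by (auto simp: generic_def sign_set_def)
  then show ?thesis
    using assms top by (simp add: cell_def z_def)
qed

text \<open>On a connected set avoiding the hyperplanes, \<open>x i - x j\<close> takes an interval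
  of values omitting \<open>a\<close>, so no sign changes. Conversely, two points of a cell are
  joined by a segment inside it.\<close>

lemma connected_component_of_arrangement:
  "connected_component_of
     (subtopology (Euclidean_space n) {x \<in> topspace (Euclidean_space n). generic A {..<n} x}) x y \<longleftrightarrow>
   generic A {..<n} x \<and> x \<in> topspace (Euclidean_space n) \<and> y \<in> cell A n (sign_set A {..<n} x)"
  (is "connected_component_of (subtopology _ ?G) x y \<longleftrightarrow> ?R")
proof
  assume "connected_component_of (subtopology (Euclidean_space n) ?G) x y"
  then obtain T where T: "connectedin (Euclidean_space n) T" "T \<subseteq> ?G" "x \<in> T" "y \<in> T"
    by (auto simp: connected_component_of_def connectedin_subtopology)
  have "a < x i - x j \<longleftrightarrow> a < y i - y j" if ij: "i < j" "j < n" "a \<in> A" for i j a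
  proof -
    let ?I = "(\<lambda>x. x i - x j) ` T"
    have "connected ?I"
      using connectedin_continuous_map_image[OF continuous_map_Euclidean_space_diff T(1)]
      by simp
    moreover have "x i - x j \<in> ?I" "y i - y j \<in> ?I"
      using T by auto
    moreover have "a \<notin> ?I"
      using T(2) ij by (auto simp: generic_def)
    ultimately show ?thesis
      by (meson connected_contains_Icc atLeastAtMost_iff linorder_not_less less_imp_le subset_iff)
  qed
  then have "sign_set A {..<n} y = sign_set A {..<n} x"
    by (auto simp: sign_set_def)
  then show ?R
    using T by (auto simp: cell_def)
next
  assume ?R
  then have xy: "x \<in> cell A n (sign_set A {..<n} x)" "y \<in> cell A n (sign_set A {..<n} x)"
    by (auto simp: cell_def)
  let ?T = "(\<lambda>t i. (1 - t) * x i + t * y i) ` {0..1::real}"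
  have "connectedin (Euclidean_space n) ?T"
    using xy by (intro connectedin_segment) (auto simp: cell_def)
  moreover have "?T \<subseteq> ?G"
    using segment_in_cell[OF xy] by (auto simp: cell_def)
  moreover have "x \<in> ?T"
    by (rule image_eqI[of _ _ 0]) auto
  moreover have "y \<in> ?T"
    by (rule image_eqI[of _ _ 1]) auto
  ultimately show "connected_component_of (subtopology (Euclidean_space n) ?G) x y"
    by (auto simp: connected_component_of_def connectedin_subtopology)
qed

text \<open>\<open>sign_sets\<close> ranges over all functions; setting the coordinates
  \<open>\<ge> n\<close> to 0 changes no sign and lands in \<open>Euclidean_space n\<close>.\<close>

lemma sign_sets_Euclidean_space:
  "sign_sets A {..<n} =
    sign_set A {..<n} ` {x \<in> topspace (Euclidean_space n). generic A {..<n} x}"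
proof (rule subset_antisym)
  show "sign_sets A {..<n} \<subseteq> sign_set A {..<n} ` {x \<in> topspace (Euclidean_space n). generic A {..<n} x}"
  proof
    fix \<sigma> assume "\<sigma> \<in> sign_sets A {..<n}"
    then obtain x where x: "generic A {..<n} x" "\<sigma> = sign_set A {..<n} x"
      by (auto simp: sign_sets_def)
    define y where "y i = (if i < n then x i else 0)" for i
    have "generic A {..<n} y" "\<sigma> = sign_set A {..<n} y"
      using x generic_cong[of "{..<n}" x y] sign_set_cong[of "{..<n}" x y] by (auto simp: y_def)
    moreover have "y \<in> topspace (Euclidean_space n)"
      by (simp add: topspace_Euclidean_space y_def)
    ultimately show "\<sigma> \<in> sign_set A {..<n} ` {x \<in> topspace (Euclidean_space n). generic A {..<n} x}"
      by blast
  qed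
qed (auto simp: sign_sets_def)

lemma cell_nonempty: "\<sigma> \<in> sign_sets A {..<n} \<Longrightarrow> cell A n \<sigma> \<noteq> {}"
  by (auto simp: sign_sets_Euclidean_space cell_def)

lemma regions_arrangement_B: "regions n (arrangement_B A n) = cell A n ` sign_sets A {..<n}"
proof -
  let ?G = "{x \<in> topspace (Euclidean_space n). generic A {..<n} x}"
  have "connected_component_of_set (subtopology (Euclidean_space n) ?G) x =
      cell A n (sign_set A {..<n} x)" if "x \<in> ?G" for x
    using that by (auto simp: connected_component_of_arrangement)
  then show ?thesis
    unfolding regions_def complement_arrangement_B connected_components_of_def sign_sets_Euclidean_space
    by (auto simp: image_iff)
qed

lemma inj_on_cell: "inj_on (cell A n) (sign_sets A {..<n})"
proof (rule inj_onI)
  fix \<sigma> \<tau> assume *: "\<sigma> \<in> sign_sets A {..<n}" "cell A n \<sigma> = cell A n \<tau>"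
  then obtain x where "x \<in> cell A n \<sigma>" "x \<in> cell A n \<tau>"
    using cell_nonempty by blast
  then show "\<sigma> = \<tau>"
    by (simp add: cell_def)
qed

section \<open>The level of a cell\<close>

text \<open>If instead \<open>X \<subseteq> V\<close>, the cardinalities force equality. This serves
  the inductions that adjoin members of a chain by increasing size.\<close>

lemma chain_max:
  assumes "\<And>U V. U \<in> insert X F \<Longrightarrow> V \<in> insert X F \<Longrightarrow> U \<subseteq> V \<or> V \<subseteq> U"
    and "\<And>U. U \<in> insert X F \<Longrightarrow> finite U" and "\<And>V. V \<in> F \<Longrightarrow> card V \<le> card X"
    and "V \<in> F"
  shows "V \<subseteq> X"
  using assms by (metis card_seteq insertCI order_refl)

text \<open>The union of a nonempty finite chain is its largest member, hence a proper subset of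
  \<open>X\<close>.\<close>

lemma chain_new_element:
  assumes "finite F" "X \<noteq> {}" "X \<notin> F" "\<And>V. V \<in> F \<Longrightarrow> V \<subseteq> X"
    and "\<And>U V. U \<in> F \<Longrightarrow> V \<in> F \<Longrightarrow> U \<subseteq> V \<or> V \<subseteq> U"
  obtains i where "i \<in> X" "\<And>V. V \<in> F \<Longrightarrow> i \<notin> V"
proof (cases "F = {}")
  case True
  then show ?thesis
    using assms(2) that by blast
next
  case False
  then have "\<Union>F \<in> F"
    using assms(1,5) by (intro finite_Sup_in) (metis sup.absorb1 sup.absorb2)+
  then have "\<Union>F \<noteq> X" "\<Union>F \<subseteq> X"
    using assms by auto
  then show ?thesis
    using that by blast
qed

text \<open>Sets are added by increasing size. A new set has an index \<open>i\<close> outside all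
  earlier ones; evaluation at \<open>i\<close> kills the earlier span but not the new
  indicator.\<close>

lemma independent_indicator_chain:
  fixes F :: "nat set set"
  assumes "finite F" and "\<And>U. U \<in> F \<Longrightarrow> finite U \<and> U \<noteq> {}"
    and "\<And>U V. U \<in> F \<Longrightarrow> V \<in> F \<Longrightarrow> U \<subseteq> V \<or> V \<subseteq> U"
  shows "rfun.independent (indicator ` F :: (nat \<Rightarrow> real) set)"
  using assms
proof (induction F rule: finite_ranking_induct[where f = card])
  case empty
  then show ?case
    by (simp add: rfun.independent_empty)
next
  case (insert X F)
  show ?case
  proof (cases "X \<in> F")
    \<comment> \<open>The induction rule allows the added element to be present already.\<close>
    case True
    then show ?thesis
      using insert by (simp add: insert_absorb)
  next
    case False
    have "V \<subseteq> X" if "V \<in> F" for V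
      using chain_max[of X F V] insert.hyps insert.prems(1,2) that by blast
    then obtain i where i: "i \<in> X" "\<And>V. V \<in> F \<Longrightarrow> i \<notin> V"
      using chain_new_element[of F X] insert.hyps(1) insert.prems(1,2) False by (metis insertCI)
    have "rfun.span (indicator ` F) \<subseteq> {w. w i = (0::real)}"
      by (rule rfun.span_minimal) (auto simp: i rfun.subspace_def)
    then have "(indicator X :: nat \<Rightarrow> real) \<notin> rfun.span (indicator ` F)"
      using i by auto
    then show ?thesis
      using insert.IH insert.prems by (simp add: rfun.independent_insertI)
  qed
qed

text \<open>The last two hypotheses say that \<open>w\<close> is constant on each layer of the chain
  and 0 outside it. Removing the right multiple of the largest indicator reduces to the shorter
  chain.\<close>

lemma span_indicator_chain:
  fixes F :: "nat set set" and w :: "nat \<Rightarrow> real"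
  assumes "finite F" and "\<And>U. U \<in> F \<Longrightarrow> finite U \<and> U \<noteq> {}"
    and "\<And>U V. U \<in> F \<Longrightarrow> V \<in> F \<Longrightarrow> U \<subseteq> V \<or> V \<subseteq> U"
    and "\<And>i. (\<And>U. U \<in> F \<Longrightarrow> i \<notin> U) \<Longrightarrow> w i = 0"
    and "\<And>i j. (\<And>U. U \<in> F \<Longrightarrow> i \<in> U \<longleftrightarrow> j \<in> U) \<Longrightarrow> w i = w j"
  shows "w \<in> rfun.span (indicator ` F)"
  using assms
proof (induction F arbitrary: w rule: finite_ranking_induct[where f = card])
  case empty
  have "w i = 0" for i
    by (rule empty.prems(3)) simp
  then have "w = 0"
    by (simp add: fun_eq_iff)
  then show ?case
    using rfun.span_zero by metis
next
  case (insert X F)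
  show ?case
  proof (cases "X \<in> F")
    case True
    then have eq: "insert X F = F"
      by blast
    show ?thesis
      unfolding eq by (rule insert.IH) (fact insert.prems[unfolded eq])+
  next
    case False
    have sub: "V \<subseteq> X" if "V \<in> F" for V
      using chain_max[of X F V] insert.hyps insert.prems(1,2) that by blast
    then obtain k where k: "k \<in> X" "\<And>V. V \<in> F \<Longrightarrow> k \<notin> V"
      using chain_new_element[of F X] insert.hyps(1) insert.prems(1,2) False by (metis insertCI)
    \<comment> \<open>\<open>w k\<close> is the value of \<open>w\<close> on the layer of
      \<open>X\<close> outside all smaller members, so \<open>v\<close> vanishes there.\<close>
    define v where "v i = w i - w k * indicator X i" for i
    have v0: "v i = 0" if "\<And>U. U \<in> F \<Longrightarrow> i \<notin> U" for i
    proof (cases "i \<in> X")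
      case True
      then have "w i = w k"
        using that k by (intro insert.prems(4)) auto
      then show ?thesis
        using True by (simp add: v_def)
    next
      case False
      then show ?thesis
        using that insert.prems(3)[of i] by (auto simp: v_def)
    qed
    have veq: "v i = v j" if ij: "\<And>U. U \<in> F \<Longrightarrow> i \<in> U \<longleftrightarrow> j \<in> U" for i j
    \<comment> \<open>Indices inside a member of \<open>F\<close> both lie in \<open>X\<close> and
      lose the same amount; otherwise both values of \<open>v\<close> are 0.\<close>
    proof (cases "\<exists>U\<in>F. i \<in> U")
      case True
      then have X: "i \<in> X" "j \<in> X"
        using ij sub by blast+
      then have "w i = w j"
        using ij by (intro insert.prems(4)) auto
      then show ?thesis
        using X by (simp add: v_def)
    next
      case False
      then show ?thesis
        using v0[of i] v0[of j] ij by auto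
    qed
    have "v \<in> rfun.span (indicator ` F)"
    proof (rule insert.IH)
      show "finite U \<and> U \<noteq> {}" if "U \<in> F" for U
        using that by (intro insert.prems(1)) simp
      show "U \<subseteq> V \<or> V \<subseteq> U" if "U \<in> F" "V \<in> F" for U V
        using that by (intro insert.prems(2)) simp_all
    qed (use v0 veq in blast)+
    then have "v \<in> rfun.span (indicator ` insert X F)"
      using rfun.span_mono[of "indicator ` F" "indicator ` insert X F"] by blast
    moreover have "(\<lambda>i. w k * indicator X i) \<in> rfun.span (indicator ` insert X F)"
      by (intro rfun.span_scale rfun.span_base) auto
    ultimately have "v + (\<lambda>i. w k * indicator X i) \<in> rfun.span (indicator ` insert X F)"
      by (rule rfun.span_add)
    moreover have "v + (\<lambda>i. w k * indicator X i) = w"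
      by (auto simp: v_def)
    ultimately show ?thesis
      by simp
  qed
qed

section \<open>Dimension and recession directions of subspaces\<close>

lemma Euclidean_space_decompose:
  assumes "x \<in> topspace (Euclidean_space n)"
  shows "x = (\<Sum>i<n. (\<lambda>k. x i * indicator {i} k))"
proof
  fix k
  have "(\<Sum>i<n. (\<lambda>k. x i * indicator {i} k)) k = (\<Sum>i<n. x i * indicator {i} k)"
    by (induction n) auto
  also have "\<dots> = (\<Sum>i<n. if i = k then x i else 0)"
    by (intro sum.cong) (auto simp: indicator_def)
  also have "\<dots> = x k"
    using assms by (auto simp: topspace_Euclidean_space sum.delta)
  finally show "x k = (\<Sum>i<n. (\<lambda>k. x i * indicator {i} k)) k"
    by simp
qed

text \<open>The ambient function space is infinite-dimensional, so a basis of \<open>W\<close> must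
  first be shown finite, by placing it in the span of \<open>n\<close> standard vectors.\<close>

lemma card_independent_le_dim:
  assumes "rfun.independent B" "B \<subseteq> W" "W \<subseteq> topspace (Euclidean_space n)"
  shows "card B \<le> rfun.dim W"
proof -
  obtain C where C: "C \<subseteq> W" "rfun.independent C" "W \<subseteq> rfun.span C" "card C = rfun.dim W"
    by (rule rfun.basis_exists)
  let ?E = "(\<lambda>i. indicator {i} :: nat \<Rightarrow> real) ` {..<n}"
  have "C \<subseteq> rfun.span ?E"
  proof
    fix x assume "x \<in> C"
    then have "x = (\<Sum>i<n. (\<lambda>k. x i * indicator {i} k))"
      using C assms by (intro Euclidean_space_decompose) auto
    also have "\<dots> \<in> rfun.span ?E"
      by (intro rfun.span_sum rfun.span_scale rfun.span_base) auto
    finally show "x \<in> rfun.span ?E" .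
  qed
  then have "finite C"
    using rfun.independent_span_bound[of ?E C] C by blast
  then show ?thesis
    using rfun.independent_span_bound[of C B] assms C by auto
qed

text \<open>
  If \<open>v \<notin> W\<close>, a linear functional vanishing on \<open>W\<close> with value 1 at \<open>v\<close> is unbounded along the ray
  \<open>x + t v\<close> but bounded near \<open>W\<close>.
\<close>

lemma recession_direction_in_subspace:
  fixes W :: "(nat \<Rightarrow> real) set"
  assumes W: "rfun.subspace W" "W \<subseteq> topspace (Euclidean_space n)"
    and x: "x \<in> topspace (Euclidean_space n)" and v: "v \<in> topspace (Euclidean_space n)"
    and near: "\<And>t. t \<ge> 0 \<Longrightarrow> (INF w\<in>W. L2_set ((\<lambda>i. x i + t * v i) - w) {..<n}) \<le> r"
  shows "v \<in> W"
proof (rule ccontr)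
  assume "v \<notin> W"
  have "vector_space ((*) :: real \<Rightarrow> real \<Rightarrow> real)"
    by unfold_locales (simp_all add: algebra_simps)
  then have pair: "vector_space_pair (\<lambda>(c::real) (x :: nat \<Rightarrow> real) i. c * x i) ((*) :: real \<Rightarrow> real \<Rightarrow> real)"
    by (intro vector_space_pair.intro rfun.vector_space_axioms)
  obtain C where C: "C \<subseteq> W" "rfun.independent C" "W \<subseteq> rfun.span C"
    by (rule rfun.maximal_independent_subset)
  have "v \<notin> rfun.span C"
    using C W \<open>v \<notin> W\<close> rfun.span_minimal by blast
  then have "rfun.independent (insert v C)"
    using C by (simp add: rfun.independent_insertI)
  from vector_space_pair.linear_independent_extend[OF pair this, of "\<lambda>u. if u = v then 1 else 0"]
  obtain f where lin: "Vector_Spaces.linear (\<lambda>(c::real) (x :: nat \<Rightarrow> real) i. c * x i) (*) f"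
    and f: "\<And>u. u \<in> insert v C \<Longrightarrow> f u = (if u = v then 1 else 0)"
    by blast
  note hom = Vector_Spaces.linear.axioms(3)[OF lin]
  have fW: "f w = 0" if "w \<in> W" for w
  proof (rule module_hom.eq_0_on_span[OF hom, of C])
    show "w \<in> rfun.span C"
      using that C by blast
    show "f u = 0" if "u \<in> C" for u
      using that f[of u] C \<open>v \<notin> W\<close> by auto
  qed
  \<comment> \<open>On \<open>Euclidean_space n\<close>, \<open>f\<close> is the inner product with
    its vector of values at the standard basis; Cauchy-Schwarz bounds it by the norm
    \<open>M\<close> of that vector.\<close>
  define M where "M = L2_set (\<lambda>i. f (indicator {i})) {..<n}"
  have fM: "\<bar>f u\<bar> \<le> M * L2_set u {..<n}" if "u \<in> topspace (Euclidean_space n)" for u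
  proof -
    have "f u = f (\<Sum>i<n. (\<lambda>k. u i * indicator {i} k))"
      using Euclidean_space_decompose[OF that] by simp
    also have "\<dots> = (\<Sum>i<n. u i * f (indicator {i}))"
      by (simp add: module_hom.sum[OF hom] module_hom.scale[OF hom])
    finally have "\<bar>f u\<bar> \<le> (\<Sum>i<n. \<bar>u i * f (indicator {i})\<bar>)"
      by (simp add: sum_abs)
    also have "\<dots> \<le> L2_set u {..<n} * M"
      unfolding M_def abs_mult by (rule L2_set_mult_ineq)
    finally show ?thesis
      by (simp add: mult.commute)
  qed
  have bound: "t + f x \<le> M * (r + 1)" if t: "t \<ge> 0" for t
  proof -
    let ?u = "\<lambda>i. x i + t * v i"
    have "W \<noteq> {}"
      using W(1) by (auto simp: rfun.subspace_def)
    moreover have "bdd_below ((\<lambda>w. L2_set (?u - w) {..<n}) ` W)"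
      by (rule bdd_belowI[of _ 0]) auto
    moreover have "(INF w\<in>W. L2_set (?u - w) {..<n}) < r + 1"
      using near[OF t] by linarith
    \<comment> \<open>The slack 1 yields a nearby point of \<open>W\<close> without showing that the
      infimum is attained.\<close>
    ultimately obtain w where w: "w \<in> W" "L2_set (?u - w) {..<n} < r + 1"
      by (auto simp: cINF_less_iff)
    have "?u = x + (\<lambda>i. t * v i)"
      by auto
    then have "f (?u - w) = f x + t * f v - f w"
      by (simp only: module_hom.diff[OF hom] module_hom.add[OF hom] module_hom.scale[OF hom])
    also have "\<dots> = f x + t"
      using f[of v] fW[OF w(1)] by simp
    finally have "t + f x \<le> \<bar>f (?u - w)\<bar>"
      by simp
    also have "\<dots> \<le> M * L2_set (?u - w) {..<n}"
      using x v w(1) W(2) by (intro fM) (auto simp: topspace_Euclidean_space subset_iff)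
    also have "\<dots> \<le> M * (r + 1)"
      using w(2) by (intro mult_left_mono) (auto simp: M_def)
    finally show ?thesis .
  qed
  from bound[of "\<bar>M * (r + 1)\<bar> + \<bar>f x\<bar> + 1"] show False
    by simp
qed

section \<open>Computing the level\<close>

text \<open>The translation only changes differences between \<open>U\<close> and its complement.
  These already lie beyond all of \<open>A\<close> and move further away, so no hyperplane is
  crossed.\<close>

lemma cell_add_indicator:
  assumes A: "finite A" "A \<noteq> {}" and U: "U \<in> top_sets A {..<n} \<sigma>" and x: "x \<in> cell A n \<sigma>" and "t \<ge> 0"
  shows "(\<lambda>i. x i + t * indicator U i) \<in> cell A n \<sigma>"
proof -
  let ?y = "\<lambda>i. x i + t * indicator U i"
  have \<sigma>: "\<sigma> = sign_set A {..<n} x" and gen: "generic A {..<n} x"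
    using x by (auto simp: cell_def)
  have sides: "?y i - ?y j \<noteq> a \<and> (a < ?y i - ?y j \<longleftrightarrow> a < x i - x j)"
    if ij: "i < j" "j < n" "a \<in> A" for i j a
  proof -
    have ne: "x i - x j \<noteq> a"
      using gen ij by (auto simp: generic_def)
    have a: "Min A \<le> a" "a \<le> Max A"
      using A ij by auto
    consider "i \<in> U \<longleftrightarrow> j \<in> U" | "i \<in> U" "j \<notin> U" | "i \<notin> U" "j \<in> U"
      by blast
    then show ?thesis
    proof cases
      case 1
      then show ?thesis
        using ne by (auto simp: indicator_def)
    next
      case 2
      then have "far_above A \<sigma> i j"
        using U ij by (auto simp: top_sets_def)
      then have "Max A < x i - x j"
        using ij by (simp add: far_above_def \<sigma> sign_set_def)
      then show ?thesis
        using 2 \<open>t \<ge> 0\<close> a by (auto simp: indicator_def)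
    next
      case 3
      then have "far_above A \<sigma> j i"
        using U ij by (auto simp: top_sets_def)
      then have "(i, j, Min A) \<notin> \<sigma>"
        using ij by (simp add: far_above_def)
      \<comment> \<open>The inequality is weak; genericity in the form of \<open>ne\<close> excludes
        \<open>a\<close> itself when \<open>t = 0\<close>.\<close>
      then have "x i - x j \<le> Min A"
        using ij Min_in[OF A] by (auto simp: \<sigma> sign_set_def not_less simp del: Min_in)
      then show ?thesis
        using 3 \<open>t \<ge> 0\<close> a ne by (auto simp: indicator_def)
    qed
  qed
  have "generic A {..<n} ?y" "sign_set A {..<n} ?y = \<sigma>"
    using sides unfolding \<sigma> by (auto simp: generic_def sign_set_def)
  moreover have "?y \<in> topspace (Euclidean_space n)"
    using x U by (auto simp: cell_def topspace_Euclidean_space top_sets_def indicator_def)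
  ultimately show ?thesis
    by (simp add: cell_def)
qed

text \<open>Boundedness relative to \<open>i\<close> spreads from an index to every index not far
  above it. Indices never reached would be far above all reached ones, giving a top set that
  contains \<open>j\<close> but not \<open>i\<close>.\<close>

lemma cell_difference_bounded:
  assumes A: "finite A" "A \<noteq> {}"
    and i: "i < n" and j: "j < n" and same: "\<And>U. U \<in> top_sets A {..<n} \<sigma> \<Longrightarrow> j \<in> U \<Longrightarrow> i \<in> U"
  shows "\<exists>M. \<forall>x\<in>cell A n \<sigma>. x j - x i \<le> M"
proof -
  \<comment> \<open>The complement of \<open>R\<close> is empty or a top set that avoids \<open>i\<close>.\<close>
  define R where "R = {k. k < n \<and> (\<exists>M. \<forall>x\<in>cell A n \<sigma>. x k - x i \<le> M)}"
  have "i \<in> R"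
    using i by (auto simp: R_def intro: exI[of _ 0])
  have step: "k \<in> R" if m: "m \<in> R" and k: "k < n" "\<not> far_above A \<sigma> k m" for k m
  proof -
    obtain M where M: "\<And>x. x \<in> cell A n \<sigma> \<Longrightarrow> x m - x i \<le> M"
      using m by (auto simp: R_def)
    have "x k - x i \<le> \<bar>Max A\<bar> + \<bar>Min A\<bar> + M" if x: "x \<in> cell A n \<sigma>" for x
    proof -
      have \<sigma>: "\<sigma> = sign_set A {..<n} x"
        using x by (simp add: cell_def)
      have "x k - x m \<le> \<bar>Max A\<bar> + \<bar>Min A\<bar>"
      proof (cases "k < m")
        case True
        then have "\<not> Max A < x k - x m"
          using k(2) m Max_in[OF A] by (simp add: far_above_def \<sigma> sign_set_def R_def del: Max_less_iff)
        then show ?thesis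
          by linarith
      next
        case False
        then have "Min A < x m - x k"
          using k(2) by (simp add: far_above_def \<sigma> sign_set_def)
        then show ?thesis
          by linarith
      qed
      then show ?thesis
        using M[OF x] by linarith
    qed
    then show ?thesis
      using k by (auto simp: R_def)
  qed
  have "j \<in> R"
  proof (rule ccontr)
    assume "j \<notin> R"
    have "far_above A \<sigma> k m" if "k \<in> {..<n} - R" "m \<in> {..<n} - ({..<n} - R)" for k m
      using that step by auto
    then have "{..<n} - R \<in> top_sets A {..<n} \<sigma>"
      using j \<open>j \<notin> R\<close> by (auto simp: top_sets_def)
    then show False
      using same j \<open>j \<notin> R\<close> \<open>i \<in> R\<close> by blast
  qed
  then show ?thesis
    by (simp add: R_def)
qed

text \<open>Replacing each coordinate by that of a representative of its layer moves a point by a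
  bounded amount and makes it constant on layers, hence a combination of the indicators.\<close>

lemma cell_near_span:
  assumes A: "finite A" "A \<noteq> {}" and \<sigma>: "\<sigma> \<in> sign_sets A {..<n}"
  shows "\<exists>r>0. \<forall>x\<in>cell A n \<sigma>.
    \<exists>w\<in>rfun.span (indicator ` top_sets A {..<n} \<sigma>). L2_set (x - w) {..<n} \<le> r"
proof -
  let ?F = "top_sets A {..<n} \<sigma>"
  \<comment> \<open>The least index that no top set separates from \<open>i\<close>: it stays below
    \<open>n\<close>, and unseparated indices share it.\<close>
  define rep where "rep i = (LEAST k. \<forall>U\<in>?F. k \<in> U \<longleftrightarrow> i \<in> U)" for i
  have rep: "\<forall>U\<in>?F. rep i \<in> U \<longleftrightarrow> i \<in> U" for i
    unfolding rep_def by (rule LeastI[of _ i]) simp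
  have rep_lt: "rep i < n" if "i < n" for i
  proof -
    have "rep i \<le> i"
      unfolding rep_def by (rule Least_le) simp
    then show ?thesis
      using that by simp
  qed
  have "\<exists>M. \<forall>x\<in>cell A n \<sigma>. \<bar>x i - x (rep i)\<bar> \<le> M" if i: "i < n" for i
  proof -
    obtain M1 M2 where "\<forall>x\<in>cell A n \<sigma>. x i - x (rep i) \<le> M1" "\<forall>x\<in>cell A n \<sigma>. x (rep i) - x i \<le> M2"
      using cell_difference_bounded[OF A, of i n "rep i" \<sigma>] cell_difference_bounded[OF A, of "rep i" n i \<sigma>]
        i rep_lt[OF i] rep by blast
    then show ?thesis
      by (intro exI[of _ "\<bar>M1\<bar> + \<bar>M2\<bar>"]) force
  qed
  then obtain M where M: "\<And>i x. i < n \<Longrightarrow> x \<in> cell A n \<sigma> \<Longrightarrow> \<bar>x i - x (rep i)\<bar> \<le> M i"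
    by metis
  \<comment> \<open>The Euclidean norm is at most the sum of absolute values; adding 1 keeps
    \<open>r\<close> positive even for \<open>n = 0\<close>.\<close>
  define r where "r = (\<Sum>i<n. \<bar>M i\<bar>) + 1"
  have "r > 0"
    unfolding r_def by (rule add_nonneg_pos) (simp_all add: sum_nonneg)
  moreover have "\<exists>w\<in>rfun.span (indicator ` ?F). L2_set (x - w) {..<n} \<le> r" if x: "x \<in> cell A n \<sigma>" for x
  proof
    define w where "w i = (if i < n then x (rep i) else 0)" for i
    \<comment> \<open>This top set separates indices below \<open>n\<close> from the others, where
      \<open>w\<close> is 0.\<close>
    have full: "{..<n} \<in> ?F" if "n > 0"
      using that by (auto simp: top_sets_def)
    show "w \<in> rfun.span (indicator ` ?F)"
    proof (rule span_indicator_chain)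
      show "finite ?F"
        by (simp add: finite_top_sets)
      show "finite U \<and> U \<noteq> {}" if "U \<in> ?F" for U
        using that by (auto simp: top_sets_def finite_subset)
      show "U \<subseteq> V \<or> V \<subseteq> U" if "U \<in> ?F" "V \<in> ?F" for U V
        using top_sets_chain[OF A \<sigma> that] .
      show "w i = 0" if "\<And>U. U \<in> ?F \<Longrightarrow> i \<notin> U" for i
        using that[OF full] by (auto simp: w_def)
      show "w i = w j" if ij: "\<And>U. U \<in> ?F \<Longrightarrow> i \<in> U \<longleftrightarrow> j \<in> U" for i j
      proof -
        have "rep i = rep j"
          unfolding rep_def using ij by (metis (no_types, lifting))
        moreover have "i < n \<longleftrightarrow> j < n"
          using ij[OF full] by (cases "n = 0") auto
        ultimately show ?thesis
          by (simp add: w_def)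
      qed
    qed
    have "L2_set (x - w) {..<n} \<le> (\<Sum>i<n. \<bar>(x - w) i\<bar>)"
      by (rule L2_set_le_sum_abs)
    also have "\<dots> \<le> (\<Sum>i<n. \<bar>M i\<bar>)"
      using M x by (intro sum_mono) (fastforce simp: w_def)
    finally show "L2_set (x - w) {..<n} \<le> r"
      by (simp add: r_def)
  qed
  ultimately show ?thesis
    by blast
qed

text \<open>The independent indicators span a subspace near the cell, which bounds the level from
  above. Any subspace near the cell contains them as recession directions, which bounds it from
  below.\<close>

lemma level_cell:
  assumes A: "finite A" "A \<noteq> {}" and \<sigma>: "\<sigma> \<in> sign_sets A {..<n}"
  shows "level n (cell A n \<sigma>) = card (top_sets A {..<n} \<sigma>)"
proof -
  let ?F = "top_sets A {..<n} \<sigma>"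
  let ?B = "indicator ` ?F :: (nat \<Rightarrow> real) set"
  have ind: "rfun.independent ?B"
    using top_sets_chain[OF A \<sigma>]
    by (intro independent_indicator_chain) (auto simp: finite_top_sets, auto simp: top_sets_def finite_subset)
  have "inj_on (indicator :: nat set \<Rightarrow> nat \<Rightarrow> real) ?F"
    by (auto simp: inj_on_def fun_eq_iff indicator_def split: if_splits)
  then have cardB: "card ?B = card ?F"
    by (rule card_image)
  have sub: "?B \<subseteq> topspace (Euclidean_space n)"
    by (auto simp: topspace_Euclidean_space top_sets_def indicator_def)
  have "rfun.subspace (topspace (Euclidean_space n))"
    by (auto simp: rfun.subspace_def topspace_Euclidean_space)
  then have span_sub: "rfun.span ?B \<subseteq> topspace (Euclidean_space n)"
    using sub by (intro rfun.span_minimal)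
  show ?thesis
    unfolding level_def
  proof (rule Least_equality)
    obtain r where r: "r > 0" "\<And>x. x \<in> cell A n \<sigma> \<Longrightarrow> \<exists>w\<in>rfun.span ?B. L2_set (x - w) {..<n} \<le> r"
      using cell_near_span[OF A \<sigma>] by blast
    have "(INF w\<in>rfun.span ?B. L2_set (x - w) {..<n}) \<le> r" if x: "x \<in> cell A n \<sigma>" for x
    proof -
      obtain w where w: "w \<in> rfun.span ?B" "L2_set (x - w) {..<n} \<le> r"
        using r(2)[OF x] by blast
      have "(INF w\<in>rfun.span ?B. L2_set (x - w) {..<n}) \<le> L2_set (x - w) {..<n}"
        by (rule cINF_lower[OF bdd_belowI[of _ 0] w(1)]) auto
      then show ?thesis
        using w by linarith
    qed
    then show "\<exists>W r. rfun.subspace W \<and> W \<subseteq> topspace (Euclidean_space n) \<and> rfun.dim W = card ?F \<and> r > 0 \<and>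
        cell A n \<sigma> \<subseteq> {x \<in> topspace (Euclidean_space n). (INF w\<in>W. L2_set (x - w) {..<n}) \<le> r}"
      using r(1) span_sub rfun.dim_span_eq_card_independent[OF ind] cardB
      by (intro exI[of _ "rfun.span ?B"] exI[of _ r]) (auto simp: cell_def)
  next
    fix l
    assume "\<exists>W r. rfun.subspace W \<and> W \<subseteq> topspace (Euclidean_space n) \<and> rfun.dim W = l \<and> r > 0 \<and>
        cell A n \<sigma> \<subseteq> {x \<in> topspace (Euclidean_space n). (INF w\<in>W. L2_set (x - w) {..<n}) \<le> r}"
    then obtain W r where W: "rfun.subspace W" "W \<subseteq> topspace (Euclidean_space n)" "rfun.dim W = l"
      and near: "\<And>x. x \<in> cell A n \<sigma> \<Longrightarrow> (INF w\<in>W. L2_set (x - w) {..<n}) \<le> r"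
      by blast
    obtain x where x: "x \<in> cell A n \<sigma>"
      using cell_nonempty[OF \<sigma>] by blast
    have "?B \<subseteq> W"
    proof clarify
      fix U assume U: "U \<in> ?F"
      have "indicator U \<in> topspace (Euclidean_space n)"
        using sub U by blast
      then show "indicator U \<in> W"
        using recession_direction_in_subspace[OF W(1,2), of x "indicator U" r] x
          near[OF cell_add_indicator[OF A U x]] by (auto simp: cell_def)
    qed
    then show "card ?F \<le> l"
      using card_independent_le_dim[OF ind _ W(2)] W(3) cardB by simp
  qed
qed

lemma num_regions_eq_num_sign_sets:
  assumes "finite A" "A \<noteq> {}"
  shows "num_regions l n (arrangement_B A n) = num_sign_sets A {..<n} l"
proof -
  have "{X \<in> regions n (arrangement_B A n). level n X = l} =
      cell A n ` {\<sigma> \<in> sign_sets A {..<n}. card (top_sets A {..<n} \<sigma>) = l}"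
    using level_cell[OF assms] by (auto simp: regions_arrangement_B)
  moreover have "inj_on (cell A n) {\<sigma> \<in> sign_sets A {..<n}. card (top_sets A {..<n} \<sigma>) = l}"
    by (rule inj_on_subset[OF inj_on_cell]) auto
  ultimately show ?thesis
    by (simp add: num_regions_def num_sign_sets_def card_image)
qed

section \<open>Generating functions\<close>

text \<open>Products of exponential generating functions are binomial convolutions, as
  \<open>n choose i\<close> divided by \<open>fact n\<close> is
  \<open>1 / (fact i * fact (n - i))\<close>. The equivalence is used in both directions.\<close>

lemma region_egf_mult_iff:
  "region_egf l A = region_egf k A * region_egf m A \<longleftrightarrow>
    (\<forall>n. num_regions l n (arrangement_B A n) =
      (\<Sum>i=0..n. (n choose i) * num_regions k i (arrangement_B A i) *
        num_regions m (n - i) (arrangement_B A (n - i))))"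
proof -
  have "fps_nth (region_egf k A * region_egf m A) n =
      real (\<Sum>i=0..n. (n choose i) * num_regions k i (arrangement_B A i) *
        num_regions m (n - i) (arrangement_B A (n - i))) / fact n" for n
    unfolding fps_mult_nth of_nat_sum sum_divide_distrib
    by (intro sum.cong) (auto simp: region_egf_def binomial_fact)
  then show ?thesis
    unfolding fps_eq_iff by (simp add: region_egf_def del: of_nat_sum)
qed

lemma region_egf_0:
  assumes "finite A" "A \<noteq> {}"
  shows "region_egf 0 A = 1"
proof (rule fps_ext)
  fix n
  show "fps_nth (region_egf 0 A) n = fps_nth 1 n"
    using num_sign_sets_0[of "{..<n}" A]
    by (cases "n = 0")
      (auto simp: region_egf_def num_regions_eq_num_sign_sets[OF assms] num_sign_sets_empty lessThan_empty_iff)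
qed

lemma region_egf_eq_power:
  assumes "finite A" "A \<noteq> {}"
  shows "region_egf l A = region_egf 1 A ^ l"
proof (induction l)
  case 0
  then show ?case
    by (simp add: region_egf_0[OF assms])
next
  case (Suc l)
  have "region_egf (Suc l) A = region_egf 1 A * region_egf l A"
    unfolding region_egf_mult_iff num_regions_eq_num_sign_sets[OF assms]
    using num_sign_sets_Suc[OF assms] by blast
  then show ?case
    using Suc.IH by simp
qed

section \<open>Multinomial expansion\<close>

text \<open>This makes the natural-number division in \<open>multinomial\<close> exact.\<close>

lemma prod_list_fact_dvd_fact: "(\<Prod>k\<leftarrow>ns. fact k :: nat) dvd fact (sum_list ns)"
proof (induction ns)
  case (Cons k ns)
  then have "fact k * (\<Prod>k\<leftarrow>ns. fact k :: nat) dvd fact k * fact (sum_list ns)"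
    by (rule mult_dvd_mono[OF dvd_refl])
  also have "\<dots> dvd fact (k + sum_list ns)"
    by (rule fact_fact_dvd_fact)
  finally show ?case
    by simp
qed simp

text \<open>Choose the first block of size \<open>k\<close>, then distribute the rest.\<close>

lemma multinomial_Cons:
  "multinomial (k + sum_list ns) (k # ns) = (k + sum_list ns choose k) * multinomial (sum_list ns) ns"
proof -
  let ?P = "\<Prod>k\<leftarrow>ns. fact k :: nat"
  have P: "fact (sum_list ns) = multinomial (sum_list ns) ns * ?P"
    using prod_list_fact_dvd_fact[of ns] by (simp add: multinomial_def)
  have "fact (k + sum_list ns) = fact k * fact (sum_list ns) * (k + sum_list ns choose k)"
    using binomial_fact_lemma[of k "k + sum_list ns"] by simp
  also have "\<dots> = (k + sum_list ns choose k) * multinomial (sum_list ns) ns * (fact k * ?P)"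
    by (simp add: P)
  finally show ?thesis
    by (simp add: multinomial_def)
qed

lemma sum_list_positive_split:
  fixes f :: "nat list \<Rightarrow> nat"
  shows "(\<Sum>ns | length ns = Suc l \<and> sum_list ns = n \<and> (\<forall>k\<in>set ns. k \<ge> 1). f ns) =
    (\<Sum>i=1..n. \<Sum>ns | length ns = l \<and> sum_list ns = n - i \<and> (\<forall>k\<in>set ns. k \<ge> 1). f (i # ns))"
    (is "sum f (?L (Suc l) n) = _")
proof -
  \<comment> \<open>Each entry is at most the total, which leaves finitely many lists.\<close>
  have fin: "finite (?L l m)" for l m
  proof (rule finite_subset)
    show "?L l m \<subseteq> {ns. set ns \<subseteq> {..m} \<and> length ns = l}"
      by (auto intro: member_le_sum_list)
    show "finite {ns. set ns \<subseteq> {..m} \<and> length ns = l}"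
      by (rule finite_lists_length_eq) simp
  qed
  have eq: "?L (Suc l) n = (\<lambda>(i, ns). i # ns) ` (SIGMA i:{1..n}. ?L l (n - i))"
    by (auto simp: length_Suc_conv image_iff)
  have inj: "inj_on (\<lambda>(i, ns). i # ns) (SIGMA i:{1..n}. ?L l (n - i))"
    by (auto simp: inj_on_def)
  have "sum f (?L (Suc l) n) = (\<Sum>(i, ns)\<in>(SIGMA i:{1..n}. ?L l (n - i)). f (i # ns))"
    unfolding eq sum.reindex[OF inj] by (simp add: case_prod_unfold)
  also have "\<dots> = (\<Sum>i=1..n. \<Sum>ns\<in>?L l (n - i). f (i # ns))"
    by (rule sum.Sigma[symmetric]) (use fin in auto)
  finally show ?thesis .
qed

lemma num_regions_eq_multinomial_sum:
  assumes "finite A" "A \<noteq> {}"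
  shows "num_regions l n (arrangement_B A n) =
    (\<Sum>ns | length ns = l \<and> sum_list ns = n \<and> (\<forall>k\<in>set ns. k \<ge> 1).
       multinomial n ns * (\<Prod>i<l. num_regions 1 (ns ! i) (arrangement_B A (ns ! i))))"
proof (induction l arbitrary: n)
  case 0
  have eq: "{ns::nat list. length ns = 0 \<and> sum_list ns = n \<and> (\<forall>k\<in>set ns. k \<ge> 1)} = (if n = 0 then {[]} else {})"
    by auto
  show ?case
  proof (cases "n = 0")
    case True
    then show ?thesis
      unfolding eq num_regions_eq_num_sign_sets[OF assms]
      by (simp add: num_sign_sets_empty multinomial_def)
  next
    case False
    then show ?thesis
      unfolding eq num_regions_eq_num_sign_sets[OF assms]
      by (simp add: num_sign_sets_0 lessThan_empty_iff)
  qed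
next
  case (Suc l)
  let ?r = "\<lambda>m. num_regions 1 m (arrangement_B A m)"
  let ?L = "\<lambda>m. {ns::nat list. length ns = l \<and> sum_list ns = m \<and> (\<forall>k\<in>set ns. k \<ge> 1)}"
  have "region_egf (Suc l) A = region_egf 1 A * region_egf l A"
    using region_egf_eq_power[OF assms] by (metis power_Suc)
  then have "num_regions (Suc l) n (arrangement_B A n) =
      (\<Sum>i=0..n. (n choose i) * ?r i * num_regions l (n - i) (arrangement_B A (n - i)))"
    by (simp only: region_egf_mult_iff)
  \<comment> \<open>The term \<open>i = 0\<close> vanishes: in dimension 0 the only region has level
    0.\<close>
  also have "\<dots> = (\<Sum>i=1..n. (n choose i) * ?r i * num_regions l (n - i) (arrangement_B A (n - i)))"
    by (rule sum.mono_neutral_right)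
      (auto simp: num_regions_eq_num_sign_sets[OF assms] num_sign_sets_empty not_less_eq_eq)
  also have "\<dots> = (\<Sum>i=1..n. \<Sum>ns\<in>?L (n - i). multinomial n (i # ns) * (\<Prod>j<Suc l. ?r ((i # ns) ! j)))"
  proof (rule sum.cong[OF refl])
    fix i assume i: "i \<in> {1..n}"
    have "multinomial n (i # ns) * (\<Prod>j<Suc l. ?r ((i # ns) ! j)) =
        (n choose i) * ?r i * (multinomial (n - i) ns * (\<Prod>j<l. ?r (ns ! j)))" if "ns \<in> ?L (n - i)" for ns
    proof -
      have "multinomial n (i # ns) = (n choose i) * multinomial (n - i) ns"
        using multinomial_Cons[of i ns] that i by simp
      then show ?thesis
        by (simp add: prod.lessThan_Suc_shift del: prod.lessThan_Suc)
    qed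
    then show "(n choose i) * ?r i * num_regions l (n - i) (arrangement_B A (n - i)) =
        (\<Sum>ns\<in>?L (n - i). multinomial n (i # ns) * (\<Prod>j<Suc l. ?r ((i # ns) ! j)))"
      unfolding Suc.IH sum_distrib_left by (intro sum.cong) auto
  qed
  also have "\<dots> = (\<Sum>ns | length ns = Suc l \<and> sum_list ns = n \<and> (\<forall>k\<in>set ns. k \<ge> 1).
       multinomial n ns * (\<Prod>j<Suc l. ?r (ns ! j)))"
    by (rule sum_list_positive_split[symmetric])
  finally show ?case .
qed

theorem theorem1p1:
  fixes A :: "real set"
  assumes "finite A" and "A \<noteq> {}"
  shows
    "(\<forall>l. region_egf l A = region_egf 1 A ^ l) \<and>
     (\<forall>n l. num_regions l n (arrangement_B A n) =
        (\<Sum>ns | length ns = l \<and> sum_list ns = n \<and> (\<forall>k\<in>set ns. k \<ge> 1).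
           multinomial n ns * (\<Prod>i<l. num_regions 1 (ns ! i) (arrangement_B A (ns ! i))))) \<and>
     (\<forall>k l. k \<le> l \<longrightarrow> region_egf l A = region_egf k A * region_egf (l - k) A) \<and>
     (\<forall>k l n. k \<le> l \<longrightarrow> num_regions l n (arrangement_B A n) =
        (\<Sum>i=0..n. (n choose i) * num_regions k i (arrangement_B A i) *
           num_regions (l - k) (n - i) (arrangement_B A (n - i))))"
proof -
  \<comment> \<open>Both sides are powers of \<open>region_egf 1 A\<close>, and the exponents
    \<open>k\<close> and \<open>l - k\<close> add up to \<open>l\<close>.\<close>
  have "region_egf l A = region_egf k A * region_egf (l - k) A" if "k \<le> l" for k l
    using that region_egf_eq_power[OF assms] by (metis le_add_diff_inverse power_add)
  then show ?thesis
    using region_egf_eq_power[OF assms] num_regions_eq_multinomial_sum[OF assms]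
      region_egf_mult_iff by blast
qed

end
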